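(* Let $L$ be a signed alphabet. The equivalence relation $\sim$ on the free monoid $\mathcal{M}(L)$ (defined by $w\sim w'$ if and only if $T(w)=T(w')$) coincides with the congruence $\equiv$ generated by the relations (K1) and (K2). Moreover, the maps $w\mapsto T(w)$ and $T\mapsto w(T)$ define a one-to-one correspondence between the super plactic monoid $\mathrm{Pl}(L)=\mathcal{M}(L)/\equiv$ and the set of super semistandard Young tableaux over $L$. In particular, a cross-section of the plactic classes (the $\equiv$-classes) is given by the words $w(T)$, as $T$ ranges over the set of super semistandard Young tableaux over $L$.
   Context: A signed alphabet is a finite or countable totally ordered set $L$ together with an arbitrary map $|\cdot|:L\to\mathbb{Z}_2=\{0,1\}$; $L_0=\{a\in L: |a|=0\}$ and $L_1=\{a\in L:|a|=1\}$. No relation between the order and the map $|\cdot|$ is assumed. For a partition $\lambda=(\lambda_1\ge\dots\ge\lambda_m>0)$, let $D(\lambda)=\{(i,j): 1\le i\le m,\ 1\le j\le\lambda_i\}$. A super semistandard Young tableau over $L$ of shape $\lambda$ is a pair $T=(\lambda,\tau)$ with $\tau:D(\lambda)\to L$ such that, whenever the boxes involved lie in $D(\lambda)$: (i) $\tau(i,j)\le\tau(i,j+1)$, with $\tau(i,j)=\tau(i,j+1)$ only if $|\tau(i,j)|=0$; (ii) $\tau(i,j)\le\tau(i+1,j)$, with $\tau(i,j)=\tau(i+1,j)$ only if $|\tau(i,j)|=1$. The empty tableau $\varnothing$ is admitted. Row-insertion: for a tableau $T$ and $x\in L$, $[T\leftarrow x]$ is the tableau obtained as follows. Start with $i=1$.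 If row $i$ contains an entry $y$ with $x<y$ (in case $|x|=0$), respectively $x\le y$ (in case $|x|=1$), replace the leftmost such entry $y$ by $x$, then set $x:=y$, $i:=i+1$ and repeat. Otherwise append $x$ at the end of row $i$ (possibly a new row) and stop. $\mathcal{M}(L)$ is the free monoid of all words in letters of $L$ (including the empty word). For a word $w=x_1\cdots x_n$, $T(w):=[[[\varnothing\leftarrow x_1]\leftarrow x_2]\cdots\leftarrow x_n]$. For a tableau $T$, $w(T)$ is the word obtained by concatenating the rows of $T$ (each read left to right) from the bottom row up to the top row. $\equiv$ is the congruence on the monoid $\mathcal{M}(L)$ generated by the following relations, for all letters $x\le y\le z$ of $L$: (K1) $xzy\equiv zxy$, whenever ($x=y$ only if $|y|=0$) and ($y=z$ only if $|y|=1$); (K2) $yxz\equiv yzx$, whenever ($x=y$ only if $|y|=1$) and ($y=z$ only if $|y|=0$). *)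

theory Defs
  imports "HOL-Library.Countable_Set" "HOL-Library.Z2" "HOL-Algebra.Group"
begin

text \<open>
  A signed alphabet is given by a countable set \<open>L\<close> of elements of a linearly ordered type together
  with a sign map \<open>p\<close> into \<open>\<int>/2\<close> (type \<^typ>\<open>bit\<close>), of which only the values on \<open>L\<close> matter.
  The free monoid on \<open>L\<close> is \<open>lists L\<close> with concatenation.
\<close>

definition is_partition :: "nat list \<Rightarrow> bool" where
  "is_partition \<mu> \<longleftrightarrow> sorted_wrt (\<ge>) \<mu> \<and> (\<forall>k\<in>set \<mu>. k > 0)"

text \<open>Boxes are indexed from 0 rather than from 1.\<close>

definition diagram :: "nat list \<Rightarrow> (nat \<times> nat) set" where
  "diagram \<mu> = {(i, j). i < length \<mu> \<and> j < \<mu> ! i}"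

text \<open>
  A pair \<open>(\<mu>, \<tau>)\<close> with \<open>\<tau> : D(\<mu>) \<rightarrow> L\<close> is encoded by the list of its rows from top to bottom:
  \<open>\<mu>\<close> is the list of row lengths, and \<open>\<tau>(i,j)\<close> is the \<open>j\<close>-th entry of the \<open>i\<close>-th row.
\<close>

definition shape :: "'a list list \<Rightarrow> nat list" where
  "shape T = map length T"

definition entry :: "'a list list \<Rightarrow> nat \<Rightarrow> nat \<Rightarrow> 'a" where
  "entry T i j = T ! i ! j"

definition super_tableaux :: "'a::linorder set \<Rightarrow> ('a \<Rightarrow> bit) \<Rightarrow> 'a list list set" where
  "super_tableaux L p = {T.
     is_partition (shape T) \<and>
     (\<forall>(i, j) \<in> diagram (shape T). entry T i j \<in> L) \<and>
     (\<forall>i j. (i, j) \<in> diagram (shape T) \<and> (i, j + 1) \<in> diagram (shape T) \<longrightarrow>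
        entry T i j \<le> entry T i (j + 1) \<and>
        (entry T i j = entry T i (j + 1) \<longrightarrow> p (entry T i j) = 0)) \<and>
     (\<forall>i j. (i, j) \<in> diagram (shape T) \<and> (i + 1, j) \<in> diagram (shape T) \<longrightarrow>
        entry T i j \<le> entry T (i + 1) j \<and>
        (entry T i j = entry T (i + 1) j \<longrightarrow> p (entry T i j) = 1))}"

definition bumps :: "('a::linorder \<Rightarrow> bit) \<Rightarrow> 'a \<Rightarrow> 'a \<Rightarrow> bool" where
  "bumps p x y \<longleftrightarrow> (if p x = 0 then x < y else x \<le> y)"

text \<open>In the second branch of the case distinction \<open>y\<close> is the leftmost entry bumped by \<open>x\<close>.\<close>

fun row_insertion :: "('a::linorder \<Rightarrow> bit) \<Rightarrow> 'a list list \<Rightarrow> 'a \<Rightarrow> 'a list list" where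
  "row_insertion p [] x = [[x]]"
| "row_insertion p (r # rs) x =
     (case dropWhile (\<lambda>y. \<not> bumps p x y) r of
        [] \<Rightarrow> (r @ [x]) # rs
      | y # ys \<Rightarrow> (takeWhile (\<lambda>y. \<not> bumps p x y) r @ x # ys) # row_insertion p rs y)"

definition word_tableau :: "('a::linorder \<Rightarrow> bit) \<Rightarrow> 'a list \<Rightarrow> 'a list list" where
  "word_tableau p w = foldl (row_insertion p) [] w"

definition tableau_word :: "'a list list \<Rightarrow> 'a list" where
  "tableau_word T = concat (rev T)"

definition tableau_equiv :: "'a::linorder set \<Rightarrow> ('a \<Rightarrow> bit) \<Rightarrow> ('a list \<times> 'a list) set" where
  "tableau_equiv L p =
     {(w, w'). w \<in> lists L \<and> w' \<in> lists L \<and> word_tableau p w = word_tableau p w'}"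

inductive_set generated_congruence :: "'a set \<Rightarrow> ('a list \<times> 'a list) set \<Rightarrow> ('a list \<times> 'a list) set"
  for L :: "'a set" and R :: "('a list \<times> 'a list) set" where
  base: "(u, v) \<in> R \<Longrightarrow> u \<in> lists L \<Longrightarrow> v \<in> lists L \<Longrightarrow> (u, v) \<in> generated_congruence L R"
| refl: "w \<in> lists L \<Longrightarrow> (w, w) \<in> generated_congruence L R"
| sym: "(u, v) \<in> generated_congruence L R \<Longrightarrow> (v, u) \<in> generated_congruence L R"
| trans: "(u, v) \<in> generated_congruence L R \<Longrightarrow> (v, w) \<in> generated_congruence L R \<Longrightarrow>
    (u, w) \<in> generated_congruence L R"
| mult: "(u, v) \<in> generated_congruence L R \<Longrightarrow> (u', v') \<in> generated_congruence L R \<Longrightarrow>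
    (u @ u', v @ v') \<in> generated_congruence L R"

definition K1 :: "'a::linorder set \<Rightarrow> ('a \<Rightarrow> bit) \<Rightarrow> ('a list \<times> 'a list) set" where
  "K1 L p = {([x, z, y], [z, x, y]) | x y z. x \<in> L \<and> y \<in> L \<and> z \<in> L \<and> x \<le> y \<and> y \<le> z \<and>
     (x = y \<longrightarrow> p y = 0) \<and> (y = z \<longrightarrow> p y = 1)}"

definition K2 :: "'a::linorder set \<Rightarrow> ('a \<Rightarrow> bit) \<Rightarrow> ('a list \<times> 'a list) set" where
  "K2 L p = {([y, x, z], [y, z, x]) | x y z. x \<in> L \<and> y \<in> L \<and> z \<in> L \<and> x \<le> y \<and> y \<le> z \<and>
     (x = y \<longrightarrow> p y = 1) \<and> (y = z \<longrightarrow> p y = 0)}"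

definition plactic_cong :: "'a::linorder set \<Rightarrow> ('a \<Rightarrow> bit) \<Rightarrow> ('a list \<times> 'a list) set" where
  "plactic_cong L p = generated_congruence L (K1 L p \<union> K2 L p)"

definition plactic_class :: "'a::linorder set \<Rightarrow> ('a \<Rightarrow> bit) \<Rightarrow> 'a list \<Rightarrow> 'a list set" where
  "plactic_class L p w = plactic_cong L p `` {w}"

definition plactic_monoid :: "'a::linorder set \<Rightarrow> ('a \<Rightarrow> bit) \<Rightarrow> 'a list set monoid" where
  "plactic_monoid L p =
     \<lparr>carrier = lists L // plactic_cong L p,
      mult = (\<lambda>A B. \<Union>u\<in>A. \<Union>v\<in>B. plactic_class L p (u @ v)),
      one = plactic_class L p []\<rparr>"

lemma generated_congruence_lists:
  "(u, v) \<in> generated_congruence L R \<Longrightarrow> u \<in> lists L \<and> v \<in> lists L"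
  by (induction rule: generated_congruence.induct) auto

lemma equiv_plactic_cong: "equiv (lists L) (plactic_cong L p)"
proof (rule equivI)
  show "plactic_cong L p \<subseteq> lists L \<times> lists L"
    unfolding plactic_cong_def using generated_congruence_lists by fastforce
  show "refl_on (lists L) (plactic_cong L p)"
    unfolding plactic_cong_def by (rule refl_onI) (rule generated_congruence.refl)
  show "sym (plactic_cong L p)"
    unfolding plactic_cong_def by (rule symI) (rule generated_congruence.sym)
  show "trans (plactic_cong L p)"
    unfolding plactic_cong_def by (rule transI) (rule generated_congruence.trans)
qed

lemma plactic_class_mult:
  assumes "u \<in> lists L" "v \<in> lists L"
  shows "plactic_class L p u \<otimes>\<^bsub>plactic_monoid L p\<^esub> plactic_class L p v = plactic_class L p (u @ v)"
proof -
  have eq: "plactic_class L p (u' @ v') = plactic_class L p (u @ v)"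
    if "u' \<in> plactic_class L p u" "v' \<in> plactic_class L p v" for u' v'
  proof -
    have "(u, u') \<in> generated_congruence L (K1 L p \<union> K2 L p)"
      "(v, v') \<in> generated_congruence L (K1 L p \<union> K2 L p)"
      using that by (simp_all only: plactic_class_def plactic_cong_def Image_singleton_iff)
    then have "(u @ v, u' @ v') \<in> plactic_cong L p"
      unfolding plactic_cong_def by (rule generated_congruence.mult)
    then show ?thesis
      unfolding plactic_class_def by (rule equiv_class_eq[OF equiv_plactic_cong, symmetric])
  qed
  have self: "w \<in> plactic_class L p w" if "w \<in> lists L" for w
    unfolding plactic_class_def using equiv_plactic_cong that by (rule equiv_class_self)
  have "(\<Union>u'\<in>plactic_class L p u. \<Union>v'\<in>plactic_class L p v. plactic_class L p (u' @ v'))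
      = (\<Union>u'\<in>plactic_class L p u. \<Union>v'\<in>plactic_class L p v. plactic_class L p (u @ v))"
    by (intro SUP_cong HOL.refl eq)
  also have "\<dots> = plactic_class L p (u @ v)"
    using self[OF assms(1)] self[OF assms(2)] by blast
  finally show ?thesis
    by (simp only: plactic_monoid_def monoid.simps)
qed

lemma carrier_plactic_monoid: "carrier (plactic_monoid L p) = plactic_class L p ` lists L"
  by (auto simp: plactic_monoid_def quotient_def plactic_class_def)

lemma monoid_plactic_monoid: "monoid (plactic_monoid L p)"
proof -
  have one: "\<one>\<^bsub>plactic_monoid L p\<^esub> = plactic_class L p []"
    by (simp add: plactic_monoid_def)
  show ?thesis
  proof (rule monoidI, unfold carrier_plactic_monoid one)
    fix A B
    assume "A \<in> plactic_class L p ` lists L" "B \<in> plactic_class L p ` lists L"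
    then obtain u v where A: "A = plactic_class L p u" and u: "u \<in> lists L"
      and B: "B = plactic_class L p v" and v: "v \<in> lists L" by (elim imageE)
    have uv: "u @ v \<in> lists L" using u v by simp
    then show "A \<otimes>\<^bsub>plactic_monoid L p\<^esub> B \<in> plactic_class L p ` lists L"
      unfolding A B plactic_class_mult[OF u v] by (rule imageI)
    fix C
    assume "C \<in> plactic_class L p ` lists L"
    then obtain w where C: "C = plactic_class L p w" and w: "w \<in> lists L" by (elim imageE)
    have vw: "v @ w \<in> lists L" using v w by simp
    show "A \<otimes>\<^bsub>plactic_monoid L p\<^esub> B \<otimes>\<^bsub>plactic_monoid L p\<^esub> C
        = A \<otimes>\<^bsub>plactic_monoid L p\<^esub> (B \<otimes>\<^bsub>plactic_monoid L p\<^esub> C)"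
      unfolding A B C plactic_class_mult[OF u v] plactic_class_mult[OF v w]
        plactic_class_mult[OF uv w] plactic_class_mult[OF u vw] by simp
  next
    show "plactic_class L p [] \<in> plactic_class L p ` lists L" by (rule imageI) simp
  next
    fix A assume "A \<in> plactic_class L p ` lists L"
    then obtain u where A: "A = plactic_class L p u" and u: "u \<in> lists L" by (elim imageE)
    show "plactic_class L p [] \<otimes>\<^bsub>plactic_monoid L p\<^esub> A = A"
      unfolding A using plactic_class_mult[OF lists.Nil u] by simp
    show "A \<otimes>\<^bsub>plactic_monoid L p\<^esub> plactic_class L p [] = A"
      unfolding A using plactic_class_mult[OF u lists.Nil] by simp
  qed
qed

end

theory Submission imports Defs begin

text \<open>
  Everything is controlled by two relations on letters: \<open>x\<close> may stand immediately to the left of \<open>y\<close>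
  in a row (\<open>row_le\<close>), and \<open>x\<close> may stand immediately above \<open>y\<close> in a column (\<open>bumps\<close>). The first is the
  reversed complement of the second, both are transitive, and a composite of the two, in either
  order, is contained in both. These rules are all that the proof uses about signs, so it runs
  as for ordinary tableaux; Greene's invariants are not needed.

  Insertion of a word into a tableau can be organised row by row: a row absorbs the word and emits
  the word of bumped letters, which is inserted into the rest of the tableau. Four facts follow from
  a study of a single row.

  \<^item> Insertion preserves tableaux (\<open>row_insertion_super_tableaux\<close>), because a bumped letter
    enters the next row weakly to the left of its old place.
  \<^item> Inserting \<open>x\<close> changes the reading word of a tableau followed by \<open>x\<close> only by (K1) and (K2)
    (\<open>row_insertion_plactic_cong\<close>); hence every word \<open>w\<close> is congruent to \<open>w(T(w))\<close>.
  \<^item> A row inserted into the row below it in a tableau replaces this row and emits it unchanged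
    (\<open>row_bump_word_dominates\<close>); hence \<open>T(w(T)) = T\<close>.
  \<^item> The two sides of (K1) or (K2), inserted into a row, lead to the same row and emit words that
    are equal or again the two sides of (K1) or (K2) (\<open>row_bump_word_knuth\<close>); by induction on the
    rows, congruent words have the same tableau (\<open>foldl_row_insertion_plactic_cong\<close>).

  The first, second and fourth facts give that two words are congruent if and only if they have the
  same tableau, and the third one makes \<open>T \<mapsto> w(T)\<close> a section of \<open>w \<mapsto> T(w)\<close>.
\<close>

section \<open>The row and column relations\<close>

text \<open>
  \<open>row_le p x y\<close> says that \<open>x y\<close> is a row: \<open>x \<le> y\<close>, with equality only for letters of sign 0.
  Dually, \<open>bumps p x y\<close> says that \<open>x\<close> above \<open>y\<close> is a column: \<open>x \<le> y\<close>, with equality only for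
  letters of sign 1.
\<close>

abbreviation row_le :: "('a::linorder \<Rightarrow> bit) \<Rightarrow> 'a \<Rightarrow> 'a \<Rightarrow> bool" where
  "row_le p x y \<equiv> \<not> bumps p y x"

lemma bumps_iff: "bumps p x y \<longleftrightarrow> x < y \<or> x = y \<and> p x = 1"
  by (cases "p x") (auto simp: bumps_def less_le)

lemma row_le_iff: "row_le p x y \<longleftrightarrow> x < y \<or> x = y \<and> p x = 0"
  by (cases "p y") (auto simp: bumps_def)

lemma bumps_trans: "bumps p x y \<Longrightarrow> bumps p y z \<Longrightarrow> bumps p x z"
  by (auto simp: bumps_iff)

lemma row_le_trans: "row_le p x y \<Longrightarrow> row_le p y z \<Longrightarrow> row_le p x z"
  by (auto simp: row_le_iff)

lemma row_le_bumps_trans: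
  "row_le p x y \<Longrightarrow> bumps p y z \<Longrightarrow> bumps p x z"
  "row_le p x y \<Longrightarrow> bumps p y z \<Longrightarrow> row_le p x z"
  unfolding row_le_iff bumps_iff by auto

lemma bumps_row_le_trans:
  "bumps p x y \<Longrightarrow> row_le p y z \<Longrightarrow> bumps p x z"
  "bumps p x y \<Longrightarrow> row_le p y z \<Longrightarrow> row_le p x z"
  unfolding row_le_iff bumps_iff by auto

section \<open>Insertion into a single row\<close>

abbreviation row :: "('a::linorder \<Rightarrow> bit) \<Rightarrow> 'a list \<Rightarrow> bool" where
  "row p \<equiv> sorted_wrt (row_le p)"

text \<open>
  Insertion of the letter \<open>x\<close> into the row \<open>r\<close>: the new row, and the word of bumped letters,
  which is empty if \<open>x\<close> is appended and has length one otherwise.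
\<close>

definition row_bump :: "('a::linorder \<Rightarrow> bit) \<Rightarrow> 'a list \<Rightarrow> 'a \<Rightarrow> 'a list \<times> 'a list" where
  "row_bump p r x = (case dropWhile (\<lambda>y. \<not> bumps p x y) r of
      [] \<Rightarrow> (r @ [x], [])
    | y # ys \<Rightarrow> (takeWhile (\<lambda>y. \<not> bumps p x y) r @ x # ys, [y]))"

text \<open>
  Insertion of a word into a row, letter by letter: the final row, and the letters bumped on the
  way, in order.
\<close>

fun row_bump_word :: "('a::linorder \<Rightarrow> bit) \<Rightarrow> 'a list \<Rightarrow> 'a list \<Rightarrow> 'a list \<times> 'a list" where
  "row_bump_word p r [] = (r, [])"
| "row_bump_word p r (x # w) =
     (let (r', u) = row_bump p r x; (r'', v) = row_bump_word p r' w in (r'', u @ v))"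

lemma row_bump_append:
  "\<forall>e\<in>set r. row_le p e x \<Longrightarrow> row_bump p r x = (r @ [x], [])"
  by (simp add: row_bump_def dropWhile_eq_Nil_conv[THEN iffD2])

lemma row_bump_replace:
  "\<forall>e\<in>set a. row_le p e x \<Longrightarrow> bumps p x y \<Longrightarrow> row_bump p (a @ y # b) x = (a @ x # b, [y])"
  by (simp add: row_bump_def)

lemma row_bump_cases:
  obtains (append) "\<forall>e\<in>set r. row_le p e x" "row_bump p r x = (r @ [x], [])"
  | (replace) a y b where "r = a @ y # b" "\<forall>e\<in>set a. row_le p e x" "bumps p x y"
      "row_bump p r x = (a @ x # b, [y])"
proof (cases "\<forall>e\<in>set r. row_le p e x")
  case True
  then show ?thesis using append row_bump_append by blast
next
  case False
  then have "\<exists>e\<in>set r. bumps p x e" by blast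
  then obtain a y b where "r = a @ y # b" "bumps p x y" "\<forall>e\<in>set a. row_le p e x"
    using split_list_first_prop by metis
  then show ?thesis using replace row_bump_replace by blast
qed

lemma row_fst_row_bump:
  assumes "row p r"
  shows "row p (fst (row_bump p r x))"
proof (cases rule: row_bump_cases[of r p x])
  case append
  then show ?thesis using assms by (simp add: sorted_wrt_append)
next
  case (replace a y b)
  then show ?thesis using assms
    by (auto simp: sorted_wrt_append dest: bumps_row_le_trans)
qed

section \<open>Insertion into a tableau, row by row\<close>

lemma row_insertion_Cons:
  "row_insertion p (r # rs) x =
    fst (row_bump p r x) # foldl (row_insertion p) rs (snd (row_bump p r x))"
  by (simp add: row_bump_def split: list.split del: dropWhile_eq_Nil_conv)

lemma foldl_row_insertion_Cons:
  "foldl (row_insertion p) (r # rs) w =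
    fst (row_bump_word p r w) # foldl (row_insertion p) rs (snd (row_bump_word p r w))"
  by (induction w arbitrary: r rs)
    (simp_all add: row_insertion_Cons split_beta Let_def del: row_insertion.simps(2))

text \<open>
  A letter that leaves the last row starts a new row, as if it were inserted into an empty row;
  so the empty tableau may be replaced by one empty row, provided that something is inserted.
\<close>

lemma foldl_row_insertion_Nil:
  "w \<noteq> [] \<Longrightarrow> foldl (row_insertion p) [] w = foldl (row_insertion p) [[]] w"
  by (cases w) simp_all

section \<open>Invariance of insertion under the relations\<close>

text \<open>
  (K1) and (K2) for all letters of the type: insertion depends on the sign map, but not on the
  set of letters that forms the alphabet.
\<close>

abbreviation knuth :: "('a::linorder \<Rightarrow> bit) \<Rightarrow> ('a list \<times> 'a list) set" where
  "knuth p \<equiv> K1 UNIV p \<union> K2 UNIV p"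

lemma K1_iff: "(u, v) \<in> K1 L p \<longleftrightarrow> (\<exists>x y z. u = [x, z, y] \<and> v = [z, x, y] \<and>
    {x, y, z} \<subseteq> L \<and> row_le p x y \<and> bumps p y z)"
  unfolding K1_def row_le_iff bumps_iff by (auto simp: le_less)

lemma K2_iff: "(u, v) \<in> K2 L p \<longleftrightarrow> (\<exists>x y z. u = [y, x, z] \<and> v = [y, z, x] \<and>
    {x, y, z} \<subseteq> L \<and> bumps p x y \<and> row_le p y z)"
  unfolding K2_def row_le_iff bumps_iff by (auto simp: le_less)

text \<open>
  The letters of a row that a given letter does not bump form an initial segment.
\<close>

lemma row_split:
  assumes "row p r"
  obtains a b where "r = a @ b" "\<forall>e\<in>set a. row_le p e x" "\<forall>e\<in>set b. bumps p x e"
proof (cases rule: row_bump_cases[of r p x])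
  case append
  then show ?thesis using that[of r "[]"] by simp
next
  case (replace a y b)
  then have "\<forall>e\<in>set (y # b). bumps p x e"
    using assms bumps_row_le_trans(1)[OF replace(3)] by (auto simp: sorted_wrt_append)
  then show ?thesis using that[of a "y # b"] replace by blast
qed

text \<open>
  A chain of three letters, each related to the next by one of the two relations, cuts a row into
  four segments.
\<close>

lemma row_split3:
  assumes r: "row p r" and xy: "row_le p x y \<or> bumps p x y" and yz: "row_le p y z \<or> bumps p y z"
  obtains a b c d where "r = a @ b @ c @ d" "\<forall>e\<in>set a. row_le p e x \<and> row_le p e y \<and> row_le p e z"
    "\<forall>e\<in>set b. bumps p x e \<and> row_le p e y \<and> row_le p e z"
    "\<forall>e\<in>set c. bumps p x e \<and> bumps p y e \<and> row_le p e z"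
    "\<forall>e\<in>set d. bumps p x e \<and> bumps p y e \<and> bumps p z e"
proof -
  obtain ab cd where 1: "r = ab @ cd" "\<forall>e\<in>set ab. row_le p e y" "\<forall>e\<in>set cd. bumps p y e"
    using row_split[OF r] .
  have "row p ab" "row p cd" using r 1 by (simp_all add: sorted_wrt_append)
  then obtain a b c d where 2: "ab = a @ b" "\<forall>e\<in>set a. row_le p e x" "\<forall>e\<in>set b. bumps p x e"
    "cd = c @ d" "\<forall>e\<in>set c. row_le p e z" "\<forall>e\<in>set d. bumps p z e"
    using row_split by metis
  have "\<forall>e\<in>set ab. row_le p e z"
    using 1 yz row_le_trans row_le_bumps_trans(2) by metis
  moreover have "\<forall>e\<in>set cd. bumps p x e"
    using 1 xy row_le_bumps_trans(1) bumps_trans by metis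
  ultimately show ?thesis using 1 2 that[of a b c d] by auto
qed

text \<open>
  Cut the row into the segments \<open>a\<close>, \<open>b\<close>, \<open>c\<close>, \<open>d\<close> of \<open>row_split3\<close>. If none of them is empty, \<open>x\<close>,
  \<open>y\<close>, \<open>z\<close> bump the heads of \<open>b\<close>, \<open>c\<close>, \<open>d\<close>, in both orders of insertion. If some are empty, a letter
  may bump an entry of a later segment or an inserted letter instead; in all cases only the first
  letter of \<open>b\<close> and the first two letters of \<open>c\<close> and of \<open>d\<close> matter. If \<open>d\<close> and one of \<open>b\<close>, \<open>c\<close> are
  nonempty, the emitted words are the sides of (K1). If \<open>b\<close> and \<open>c\<close> are empty and \<open>d\<close> starts with
  two letters \<open>d\<^sub>1\<close>, \<open>d\<^sub>2\<close>, they are \<open>d\<^sub>1 d\<^sub>2 z\<close> and \<open>d\<^sub>1 z d\<^sub>2\<close>, the sides of (K2) in reverse order.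
  Otherwise they are equal.
\<close>

lemma row_bump_word_K1:
  assumes r: "row p r" and xy: "row_le p x y" and yz: "bumps p y z"
  shows "\<exists>s u v. row_bump_word p r [x, z, y] = (s, u) \<and> row_bump_word p r [z, x, y] = (s, v) \<and>
    (u = v \<or> (u, v) \<in> K1 UNIV p \<or> (v, u) \<in> K2 UNIV p)"
proof -
  obtain a b c d where s: "r = a @ b @ c @ d"
    "\<forall>e\<in>set a. row_le p e x \<and> row_le p e y \<and> row_le p e z"
    "\<forall>e\<in>set b. bumps p x e \<and> row_le p e y \<and> row_le p e z"
    "\<forall>e\<in>set c. bumps p x e \<and> bumps p y e \<and> row_le p e z"
    "\<forall>e\<in>set d. bumps p x e \<and> bumps p y e \<and> bumps p z e"
    using row_split3[OF r disjI1[OF xy] disjI2[OF yz]] .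
  have xz: "row_le p x z" "bumps p x z"
    using row_le_bumps_trans[OF xy yz] by auto
  have bd: "\<forall>e\<in>set (b @ c). \<forall>e'\<in>set d. bumps p e e'"
    using s row_le_bumps_trans(1)[where y = z] by (metis Un_iff set_append)
  have bz: "\<forall>e\<in>set b. bumps p e z"
    using s row_le_bumps_trans(1)[OF _ yz] by blast
  have sb: "row p (b @ c @ d)" using r s(1) by (simp add: sorted_wrt_append)
  note rels = xz xy yz s(2-) bd bz sb
  note defs = s(1) row_bump_def dropWhile_eq_Nil_conv[THEN iffD2] sorted_wrt_append K1_iff K2_iff
  \<comment> \<open>This rule distinguishes the empty list, one letter, and at least two letters.\<close>
  show ?thesis
    using rels
    by (cases b; cases c rule: remdups_adj.cases; cases d rule: remdups_adj.cases; simp add: defs)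
qed

text \<open>
  With the same segments, \<open>y\<close> is inserted first and bumps the head of \<open>c\<close>, or of \<open>d\<close> if \<open>c\<close> is
  empty; \<open>x\<close> bumps the head of \<open>b\<close>, or \<open>y\<close> if \<open>b\<close> is empty; and \<open>z\<close> bumps the first letter of \<open>d\<close> that
  is left, or is appended. The emitted words are the sides of (K2) if \<open>z\<close> bumps a letter, and are
  equal otherwise.
\<close>

lemma row_bump_word_K2:
  assumes r: "row p r" and xy: "bumps p x y" and yz: "row_le p y z"
  shows "\<exists>s u v. row_bump_word p r [y, x, z] = (s, u) \<and> row_bump_word p r [y, z, x] = (s, v) \<and>
    (u = v \<or> (u, v) \<in> K2 UNIV p \<or> (v, u) \<in> K1 UNIV p)"
proof -
  obtain a b c d where s: "r = a @ b @ c @ d"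
    "\<forall>e\<in>set a. row_le p e x \<and> row_le p e y \<and> row_le p e z"
    "\<forall>e\<in>set b. bumps p x e \<and> row_le p e y \<and> row_le p e z"
    "\<forall>e\<in>set c. bumps p x e \<and> bumps p y e \<and> row_le p e z"
    "\<forall>e\<in>set d. bumps p x e \<and> bumps p y e \<and> bumps p z e"
    using row_split3[OF r disjI2[OF xy] disjI1[OF yz]] .
  have xz: "row_le p x z" "bumps p x z"
    using bumps_row_le_trans[OF xy yz] by auto
  have bd: "\<forall>e\<in>set b. \<forall>e'\<in>set (c @ d). bumps p e e'"
    using s row_le_bumps_trans(1)[where y = y] by auto
  have sb: "row p (b @ c @ d)" using r s(1) by (simp add: sorted_wrt_append)
  note rels = xz xy yz s(2-) bd sb
  note defs = s(1) row_bump_def dropWhile_eq_Nil_conv[THEN iffD2] sorted_wrt_append K1_iff K2_iff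
  show ?thesis
    using rels by (cases b; cases c; cases d rule: remdups_adj.cases; simp add: defs)
qed


lemma row_bump_word_knuth:
  assumes "row p r" "(w, w') \<in> knuth p \<union> (knuth p)\<inverse>"
  shows "\<exists>s u v. row_bump_word p r w = (s, u) \<and> row_bump_word p r w' = (s, v) \<and>
    (u = v \<or> (u, v) \<in> knuth p \<union> (knuth p)\<inverse>)"
proof -
  have *: "\<exists>s u v. row_bump_word p r w = (s, u) \<and> row_bump_word p r w' = (s, v) \<and>
    (u = v \<or> (u, v) \<in> knuth p \<union> (knuth p)\<inverse>)" if "(w, w') \<in> knuth p" for w w'
    using that
  proof
    assume "(w, w') \<in> K1 UNIV p"
    then obtain x y z where "w = [x, z, y]" "w' = [z, x, y]" "row_le p x y" "bumps p y z"
      by (auto simp: K1_iff)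
    then show ?thesis using row_bump_word_K1[OF assms(1), where x = x and y = y and z = z] by blast
  next
    assume "(w, w') \<in> K2 UNIV p"
    then obtain x y z where "w = [y, x, z]" "w' = [y, z, x]" "bumps p x y" "row_le p y z"
      by (auto simp: K2_iff)
    then show ?thesis using row_bump_word_K2[OF assms(1), where x = x and y = y and z = z] by blast
  qed
  from assms(2) consider "(w, w') \<in> knuth p" | "(w', w) \<in> knuth p" by blast
  then show ?thesis by cases (use * in blast)+
qed

lemma foldl_row_insertion_knuth:
  assumes "\<forall>r\<in>set T. row p r" "(w, w') \<in> knuth p \<union> (knuth p)\<inverse>"
  shows "foldl (row_insertion p) T w = foldl (row_insertion p) T w'"
  using assms
proof (induction T arbitrary: w w')
  case Nil
  \<comment> \<open>The empty tableau has no row to appeal to, so its insertions are computed directly.\<close>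
  have 1: "foldl (row_insertion p) [] [x, z, y] = foldl (row_insertion p) [] [z, x, y]"
    if "row_le p x y" "bumps p y z" for x y z
    using that row_le_bumps_trans[OF that] by simp
  have 2: "foldl (row_insertion p) [] [y, x, z] = foldl (row_insertion p) [] [y, z, x]"
    if "bumps p x y" "row_le p y z" for x y z
    using that bumps_row_le_trans[OF that] by simp
  have 3: "foldl (row_insertion p) [] w = foldl (row_insertion p) [] w'"
    if "(w, w') \<in> knuth p" for w w'
    using that by (auto simp: K1_iff K2_iff simp del: foldl.simps intro!: 1 2)
  from Nil(2) consider "(w, w') \<in> knuth p" | "(w', w) \<in> knuth p" by blast
  then show ?case by cases (use 3 in metis)+
next
  case (Cons r T)
  then obtain s u v where "row_bump_word p r w = (s, u)" "row_bump_word p r w' = (s, v)"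
    "u = v \<or> (u, v) \<in> knuth p \<union> (knuth p)\<inverse>"
    using row_bump_word_knuth[of p r w w'] by auto
  moreover from this(3) have "foldl (row_insertion p) T u = foldl (row_insertion p) T v"
    using Cons by (auto simp del: Un_iff)
  ultimately show ?case by (simp add: foldl_row_insertion_Cons)
qed

section \<open>Words are congruent to the reading words of their tableaux\<close>

lemma plactic_congI:
  "(u, v) \<in> K1 L p \<Longrightarrow> (u, v) \<in> plactic_cong L p"
  "(u, v) \<in> K2 L p \<Longrightarrow> (u, v) \<in> plactic_cong L p"
  unfolding plactic_cong_def by (rule generated_congruence.base; auto simp: K1_def K2_def)+

lemma plactic_cong_context:
  assumes "(u, v) \<in> plactic_cong L p" "set s \<subseteq> L" "set t \<subseteq> L"
  shows "(s @ u @ t, s @ v @ t) \<in> plactic_cong L p"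
  using assms unfolding plactic_cong_def
  by (intro generated_congruence.mult generated_congruence.refl) auto

lemma plactic_cong_refl: "set w \<subseteq> L \<Longrightarrow> (w, w) \<in> plactic_cong L p"
  unfolding plactic_cong_def by (rule generated_congruence.refl) auto

lemma plactic_cong_sym: "(u, v) \<in> plactic_cong L p \<Longrightarrow> (v, u) \<in> plactic_cong L p"
  unfolding plactic_cong_def by (rule generated_congruence.sym)

lemma plactic_cong_trans:
  "(u, v) \<in> plactic_cong L p \<Longrightarrow> (v, w) \<in> plactic_cong L p \<Longrightarrow> (u, w) \<in> plactic_cong L p"
  unfolding plactic_cong_def by (rule generated_congruence.trans)

text \<open>
  The inserted letter \<open>x\<close> moves left through the tail \<open>b\<close> of the row, by (K2), until it meets the
  letter \<open>y\<close> that it bumps.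
\<close>

lemma plactic_cong_slide_K2:
  assumes "row p (y # b)" "bumps p x y" "set (x # y # b) \<subseteq> L"
  shows "(y # b @ [x], y # x # b) \<in> plactic_cong L p"
  using assms
proof (induction b arbitrary: y)
  case Nil
  then show ?case by (simp add: plactic_cong_refl)
next
  case (Cons z b)
  have "(z # b @ [x], z # x # b) \<in> plactic_cong L p"
    using Cons.prems bumps_row_le_trans(1)[of p x y z] by (intro Cons.IH) auto
  from plactic_cong_context[OF this, of "[y]" "[]"]
  have 1: "(y # z # b @ [x], y # z # x # b) \<in> plactic_cong L p" using Cons.prems by simp
  have "([y, x, z], [y, z, x]) \<in> K2 L p" using Cons.prems by (simp add: K2_iff)
  from plactic_cong_context[OF plactic_congI(2)[OF this], of "[]" b]
  have "(y # x # z # b, y # z # x # b) \<in> plactic_cong L p" using Cons.prems by simp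
  with 1 show ?case using plactic_cong_trans plactic_cong_sym by fastforce
qed

text \<open>
  The bumped letter \<open>y\<close> moves left through the head \<open>a\<close> of the row, by (K1).
\<close>

lemma plactic_cong_slide_K1:
  assumes "row p (a @ [x])" "bumps p x y" "set (x # y # a) \<subseteq> L"
  shows "(a @ [y, x], y # a @ [x]) \<in> plactic_cong L p"
  using assms
proof (induction a)
  case Nil
  then show ?case by (simp add: plactic_cong_refl)
next
  case (Cons e a)
  have "(a @ [y, x], y # a @ [x]) \<in> plactic_cong L p"
    using Cons.prems by (intro Cons.IH) auto
  from plactic_cong_context[OF this, of "[e]" "[]"]
  have 1: "(e # a @ [y, x], e # y # a @ [x]) \<in> plactic_cong L p" using Cons.prems by simp
  obtain f t where ft: "a @ [x] = f # t" by (cases a) auto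
  have "row_le p e f" "f = x \<or> row_le p f x" "set (f # t) \<subseteq> L"
    using Cons.prems ft by (cases a; auto simp: sorted_wrt_append)+
  then have "([e, y, f], [y, e, f]) \<in> K1 L p"
    using Cons.prems row_le_bumps_trans(1)[where x = f and y = x and z = y] by (auto simp: K1_iff)
  from plactic_cong_context[OF plactic_congI(1)[OF this], of "[]" t]
  have "(e # y # a @ [x], y # e # a @ [x]) \<in> plactic_cong L p"
    using \<open>set (f # t) \<subseteq> L\<close> ft by simp
  with 1 show ?case using plactic_cong_trans by fastforce
qed

lemma row_bump_plactic_cong:
  assumes "row p r" "set r \<subseteq> L" "x \<in> L"
  shows "(r @ [x], snd (row_bump p r x) @ fst (row_bump p r x)) \<in> plactic_cong L p"
proof (cases rule: row_bump_cases[of r p x])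
  case append
  then show ?thesis using assms
    by (simp add: plactic_cong_refl)
next
  case (replace a y b)
  have "(y # b @ [x], y # x # b) \<in> plactic_cong L p"
    using assms replace by (intro plactic_cong_slide_K2) (auto simp: sorted_wrt_append)
  from plactic_cong_context[OF this, of a "[]"]
  have 1: "(a @ y # b @ [x], a @ y # x # b) \<in> plactic_cong L p" using assms replace by simp
  have "(a @ [y, x], y # a @ [x]) \<in> plactic_cong L p"
    using assms replace by (intro plactic_cong_slide_K1) (auto simp: sorted_wrt_append)
  from plactic_cong_context[OF this, of "[]" b]
  have "(a @ y # x # b, y # a @ x # b) \<in> plactic_cong L p" using assms replace by simp
  with 1 show ?thesis using replace plactic_cong_trans by fastforce
qed

lemma tableau_word_Cons: "tableau_word (r # T) = tableau_word T @ r"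
  by (simp add: tableau_word_def)

lemma row_insertion_plactic_cong:
  assumes "\<forall>r\<in>set T. row p r \<and> set r \<subseteq> L" "x \<in> L"
  shows "(tableau_word T @ [x], tableau_word (row_insertion p T x)) \<in> plactic_cong L p"
  using assms
proof (induction T arbitrary: x)
  case Nil
  then show ?case
    by (simp add: plactic_cong_refl tableau_word_def)
next
  case (Cons r T)
  have T: "set (tableau_word T) \<subseteq> L" using Cons.prems by (auto simp: tableau_word_def)
  have r: "row p r" "set r \<subseteq> L" using Cons.prems by auto
  from plactic_cong_context[OF row_bump_plactic_cong[OF r Cons.prems(2)] T, of "[]"]
  have 1: "(tableau_word (r # T) @ [x],
      tableau_word T @ snd (row_bump p r x) @ fst (row_bump p r x)) \<in> plactic_cong L p"
    by (simp add: tableau_word_Cons)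
  show ?case
  proof (cases rule: row_bump_cases[of r p x])
    case append
    with 1 show ?thesis
      by (simp add: row_insertion_Cons tableau_word_Cons del: row_insertion.simps(2))
  next
    case (replace a y b)
    have "(tableau_word T @ [y], tableau_word (row_insertion p T y)) \<in> plactic_cong L p"
      using Cons.prems replace by (intro Cons.IH) auto
    from plactic_cong_context[OF this, of "[]" "a @ x # b"]
    have "(tableau_word T @ [y] @ a @ x # b, tableau_word (row_insertion p T y) @ a @ x # b)
        \<in> plactic_cong L p"
      using Cons.prems replace by auto
    with 1 show ?thesis using replace plactic_cong_trans
      by (fastforce simp: row_insertion_Cons tableau_word_Cons simp del: row_insertion.simps(2))
  qed
qed

section \<open>Tableaux as lists of rows\<close>

text \<open>
  \<open>dominates p r s\<close> is the column condition for a row \<open>r\<close> lying directly above a row \<open>s\<close>, including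
  the condition on their lengths. The empty row is dominated by every row.
\<close>

definition dominates :: "('a::linorder \<Rightarrow> bit) \<Rightarrow> 'a list \<Rightarrow> 'a list \<Rightarrow> bool" where
  "dominates p r s \<longleftrightarrow> length s \<le> length r \<and> (\<forall>j<length s. bumps p (r ! j) (s ! j))"

lemma row_iff_nth:
  "row p r \<longleftrightarrow> (\<forall>j. j + 1 < length r \<longrightarrow> row_le p (r ! j) (r ! (j + 1)))"
  using sorted_wrt_iff_nth_Suc_transp[of "row_le p" r] row_le_trans
  by (auto simp: transp_def)

lemma mem_diagram_shape: "(i, j) \<in> diagram (shape T) \<longleftrightarrow> i < length T \<and> j < length (T ! i)"
  by (auto simp: diagram_def shape_def)

lemma super_tableaux_iff:
  "T \<in> super_tableaux L p \<longleftrightarrow>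
    (\<forall>r\<in>set T. r \<noteq> [] \<and> set r \<subseteq> L \<and> row p r) \<and> successively (dominates p) T"
proof -
  have le: "row_le p x y \<longleftrightarrow> x \<le> y \<and> (x = y \<longrightarrow> p x = 0)"
    "bumps p x y \<longleftrightarrow> x \<le> y \<and> (x = y \<longrightarrow> p x = 1)" for x y
    by (auto simp: row_le_iff bumps_iff)
  define dec where "dec \<longleftrightarrow> (\<forall>i. i + 1 < length T \<longrightarrow> length (T ! (i + 1)) \<le> length (T ! i))"
  have 1: "is_partition (shape T) \<longleftrightarrow> (\<forall>r\<in>set T. r \<noteq> []) \<and> dec"
    unfolding is_partition_def shape_def dec_def
    using sorted_wrt_iff_nth_Suc_transp[of "(\<ge>)" "map length T"] by (auto simp: transp_def)
  have 2: "(\<forall>(i, j) \<in> diagram (shape T). entry T i j \<in> L) \<longleftrightarrow> (\<forall>r\<in>set T. set r \<subseteq> L)"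
    by (auto simp: entry_def mem_diagram_shape all_set_conv_all_nth subset_eq)
  have 3: "(\<forall>i j. (i, j) \<in> diagram (shape T) \<and> (i, j + 1) \<in> diagram (shape T) \<longrightarrow>
        entry T i j \<le> entry T i (j + 1) \<and>
        (entry T i j = entry T i (j + 1) \<longrightarrow> p (entry T i j) = 0)) \<longleftrightarrow>
      (\<forall>r\<in>set T. row p r)"
    unfolding entry_def mem_diagram_shape all_set_conv_all_nth row_iff_nth
    unfolding le(1) by (meson add_lessD1)
  \<comment> \<open>Decreasing row lengths put the box above a box of the diagram into the diagram.\<close>
  have 4: "(\<forall>i j. (i, j) \<in> diagram (shape T) \<and> (i + 1, j) \<in> diagram (shape T) \<longrightarrow>
        entry T i j \<le> entry T (i + 1) j \<and>
        (entry T i j = entry T (i + 1) j \<longrightarrow> p (entry T i j) = 1)) \<longleftrightarrow>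
      (\<forall>i. i + 1 < length T \<longrightarrow> (\<forall>j<length (T ! (i + 1)). bumps p (T ! i ! j) (T ! (i + 1) ! j)))"
    if dec
  proof -
    have "j < length (T ! i)" if "i + 1 < length T" "j < length (T ! (i + 1))" for i j
      using \<open>dec\<close> that less_le_trans unfolding dec_def by blast
    then show ?thesis
      unfolding entry_def mem_diagram_shape le(2) by auto
  qed
  have 5: "successively (dominates p) T \<longleftrightarrow> dec \<and>
      (\<forall>i. i + 1 < length T \<longrightarrow> (\<forall>j<length (T ! (i + 1)). bumps p (T ! i ! j) (T ! (i + 1) ! j)))"
    unfolding successively_conv_nth Suc_eq_plus1 dominates_def dec_def by blast
  show ?thesis
    unfolding super_tableaux_def mem_Collect_eq 1 2 3 5 ball_conj_distrib using 4 by argo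
qed

lemma super_tableaux_Cons:
  "r # T \<in> super_tableaux L p \<longleftrightarrow> r \<noteq> [] \<and> set r \<subseteq> L \<and> row p r \<and>
    (T = [] \<or> dominates p r (hd T)) \<and> T \<in> super_tableaux L p"
  by (auto simp: super_tableaux_iff successively_Cons)

section \<open>Insertion preserves tableaux\<close>

text \<open>
  If \<open>x\<close> bumps \<open>y\<close> at position \<open>k\<close> of \<open>r\<close>, the letter of \<open>s\<close> at position \<open>k\<close>, if there is one, is bumped
  by \<open>y\<close>. So \<open>y\<close> enters \<open>s\<close> at a position \<open>m \<le> k\<close>, where the new upper row has a letter that
  bumps \<open>y\<close>.
\<close>

lemma dominates_row_bump:
  assumes r: "row p r" and rx: "row_bump p r x = (r', [y])" and rs: "dominates p r s"
  shows "dominates p r' (fst (row_bump p s y))"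
proof -
  obtain a b where a: "r = a @ y # b" "\<forall>e\<in>set a. row_le p e x" "bumps p x y" "r' = a @ x # b"
    using rx by (cases rule: row_bump_cases[of r p x]) auto
  let ?k = "length a"
  have r': "r' = r[?k := x]" "?k < length r" using a by simp_all
  have less: "bumps p (r ! j) y" if "j < ?k" for j
    using that a(1,2) row_le_bumps_trans(1)[OF _ a(3)] by (simp add: nth_append)
  have k: "r ! ?k = y" using a by simp
  have below: "m \<le> ?k" if "m \<le> length s" "\<forall>j<m. row_le p (s ! j) y" for m
  proof (rule ccontr)
    assume "\<not> m \<le> ?k"
    then have "?k < m" by simp
    then have "row_le p (s ! ?k) y" using that(2) by blast
    moreover have "bumps p y (s ! ?k)"
      using \<open>?k < m\<close> that(1) rs k unfolding dominates_def by (metis order_less_le_trans)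
    ultimately show False by simp
  qed
  have main: "bumps p (r' ! m) y" if "m \<le> ?k" for m
    using that a(1,4) less[of m] by (cases "m = ?k") (auto simp: nth_append a(3))
  have rest: "bumps p (r' ! j) (s ! j)" if "j < length s" for j
    using that rs k r' bumps_trans[OF a(3)] by (cases "j = ?k") (auto simp: dominates_def)
  show ?thesis
  proof (cases rule: row_bump_cases[of s p y])
    case append
    then have "length s \<le> ?k" using below by simp
    then show ?thesis using append rest main r' by (auto simp: dominates_def nth_append less_Suc_eq)
  next
    case (replace c z d)
    then have "length c \<le> ?k" using below[of "length c"] by (simp add: nth_append)
    moreover have "fst (row_bump p s y) = s[length c := y]" using replace by simp
    moreover have "length r' = length r" using r' by simp
    ultimately have "bumps p (r' ! j) (fst (row_bump p s y) ! j)" if "j < length s" for j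
      using that rest main by (cases "j = length c") auto
    then show ?thesis using replace rs \<open>length r' = length r\<close> by (auto simp: dominates_def)
  qed
qed

lemma row_insertion_super_tableaux:
  assumes "T \<in> super_tableaux L p" "x \<in> L"
  shows "row_insertion p T x \<in> super_tableaux L p"
  using assms
proof (induction T arbitrary: x)
  case Nil
  then show ?case by (simp add: super_tableaux_iff)
next
  case (Cons r T)
  then have r: "row p r" "r \<noteq> []" "set r \<subseteq> L" "T = [] \<or> dominates p r (hd T)"
    and T: "T \<in> super_tableaux L p"
    by (auto simp: super_tableaux_Cons)
  show ?case
  proof (cases rule: row_bump_cases[of r p x])
    case append
    have "dominates p r s \<Longrightarrow> dominates p (r @ [x]) s" for s
      by (auto simp: dominates_def nth_append)
    then show ?thesis
      using r T append Cons.prems row_fst_row_bump[OF r(1), of x]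
      by (auto simp: row_insertion_Cons super_tableaux_Cons simp del: row_insertion.simps(2))
  next
    case (replace a y b)
    have IH: "row_insertion p T y \<in> super_tableaux L p"
      using Cons.IH[OF T] replace r by simp
    have "dominates p (a @ x # b) (hd (row_insertion p T y))"
    proof (cases T)
      case Nil
      \<comment> \<open>A new row created at the bottom arises from the empty row.\<close>
      have "dominates p r []" by (simp add: dominates_def)
      from dominates_row_bump[OF r(1) replace(4) this] Nil show ?thesis
        by (simp add: row_bump_def)
    next
      case (Cons s T')
      then show ?thesis using dominates_row_bump[OF r(1) replace(4), of s] r
        by (simp add: row_insertion_Cons del: row_insertion.simps(2))
    qed
    then show ?thesis
      using IH r replace Cons.prems row_fst_row_bump[OF r(1), of x]
      by (auto simp: row_insertion_Cons super_tableaux_Cons simp del: row_insertion.simps(2))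
  qed
qed

lemma foldl_row_insertion_super_tableaux:
  "T \<in> super_tableaux L p \<Longrightarrow> set w \<subseteq> L \<Longrightarrow> foldl (row_insertion p) T w \<in> super_tableaux L p"
  by (induction w arbitrary: T) (auto intro: row_insertion_super_tableaux)


section \<open>The tableau of a reading word\<close>

lemma row_bump_word_append:
  "row_bump_word p r (u @ v) =
    (let (s, u') = row_bump_word p r u; (s', v') = row_bump_word p s v in (s', u' @ v'))"
  by (induction u arbitrary: r) (auto simp: split_beta Let_def)

text \<open>
  The \<open>j\<close>-th letter of \<open>r\<close> bumps the \<open>j\<close>-th letter of \<open>s\<close>, or is appended if \<open>s\<close> has no such letter.
\<close>

lemma row_bump_word_dominates:
  assumes "row p r" "dominates p r s"
  shows "row_bump_word p s r = (r, s)"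
proof -
  have "row_bump_word p s (take j r) = (take j r @ drop j s, take j s)" if "j \<le> length r" for j
    using that
  proof (induction j)
    case 0
    then show ?case by simp
  next
    case (Suc j)
    then have j: "j < length r" by simp
    have le: "\<forall>e\<in>set (take j r). row_le p e (r ! j)"
      using assms(1) j by (auto simp: in_set_conv_nth sorted_wrt_iff_nth_less)
    have "row_bump p (take j r @ drop j s) (r ! j) =
        (take (Suc j) r @ drop (Suc j) s, drop j (take (Suc j) s))"
    proof (cases "j < length s")
      case True
      then have "bumps p (r ! j) (s ! j)" using assms(2) by (simp add: dominates_def)
      from row_bump_replace[OF le this, of "drop (Suc j) s"] show ?thesis
        using True j by (simp add: Cons_nth_drop_Suc take_Suc_conv_app_nth)
    next
      case False
      then show ?thesis using row_bump_append[OF le] j by (simp add: take_Suc_conv_app_nth)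
    qed
    moreover have "take (Suc j) s = take j s @ drop j (take (Suc j) s)"
      by (metis append_take_drop_id min.absorb1 le_SucI order_refl take_take)
    ultimately show ?case
      using Suc j by (simp add: take_Suc_conv_app_nth[OF j] row_bump_word_append)
  qed
  from this[of "length r"] show ?thesis using assms(2) by (simp add: dominates_def)
qed

text \<open>
  Inserting the top row of a tableau into the remaining rows pushes each of them down by one.
\<close>

lemma foldl_row_insertion_row:
  assumes "r # T \<in> super_tableaux L p"
  shows "foldl (row_insertion p) T r = r # T"
  using assms
proof (induction T arbitrary: r)
  case Nil
  have "row_bump_word p [] r = (r, [])"
    using Nil by (intro row_bump_word_dominates) (auto simp: super_tableaux_Cons dominates_def)
  moreover have "foldl (row_insertion p) [] r = foldl (row_insertion p) [[]] r"
    using Nil by (intro foldl_row_insertion_Nil) (simp add: super_tableaux_Cons)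
  ultimately show ?case by (simp add: foldl_row_insertion_Cons)
next
  case (Cons s T)
  then have "row_bump_word p s r = (r, s)"
    by (intro row_bump_word_dominates) (auto simp: super_tableaux_Cons)
  then show ?case using Cons by (simp add: foldl_row_insertion_Cons super_tableaux_Cons)
qed

lemma word_tableau_tableau_word:
  "T \<in> super_tableaux L p \<Longrightarrow> word_tableau p (tableau_word T) = T"
proof (induction T)
  case Nil
  then show ?case by (simp add: word_tableau_def tableau_word_def)
next
  case (Cons r T)
  then show ?case using foldl_row_insertion_row[OF Cons.prems]
    by (simp add: tableau_word_Cons word_tableau_def super_tableaux_Cons)
qed

lemma word_tableau_super_tableaux:
  "w \<in> lists L \<Longrightarrow> word_tableau p w \<in> super_tableaux L p"
  unfolding word_tableau_def
  by (rule foldl_row_insertion_super_tableaux) (auto simp: super_tableaux_iff)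

lemma tableau_word_lists: "T \<in> super_tableaux L p \<Longrightarrow> tableau_word T \<in> lists L"
  by (simp add: super_tableaux_iff tableau_word_def lists_eq_set) blast

lemma plactic_cong_tableau_word:
  "w \<in> lists L \<Longrightarrow> (w, tableau_word (word_tableau p w)) \<in> plactic_cong L p"
proof (induction w rule: rev_induct)
  case Nil
  then show ?case by (simp add: word_tableau_def tableau_word_def plactic_cong_refl)
next
  case (snoc x w)
  then have w: "w \<in> lists L" "x \<in> L" by auto
  have "(w @ [x], tableau_word (word_tableau p w) @ [x]) \<in> plactic_cong L p"
    using plactic_cong_context[OF snoc.IH[OF w(1)], of "[]" "[x]"] w by simp
  moreover have "(tableau_word (word_tableau p w) @ [x],
      tableau_word (row_insertion p (word_tableau p w) x)) \<in> plactic_cong L p"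
    using word_tableau_super_tableaux[OF w(1), of p] w(2)
    by (intro row_insertion_plactic_cong) (auto simp: super_tableaux_iff)
  ultimately show ?case using plactic_cong_trans by (fastforce simp: word_tableau_def)
qed

section \<open>The correspondence\<close>

text \<open>
  Stated for insertion into an arbitrary tableau, since a product \<open>u @ u'\<close> of words inserts \<open>u'\<close>
  into the result of inserting \<open>u\<close>.
\<close>

lemma foldl_row_insertion_plactic_cong:
  assumes "(u, v) \<in> plactic_cong L p" "T \<in> super_tableaux L p"
  shows "foldl (row_insertion p) T u = foldl (row_insertion p) T v"
  using assms unfolding plactic_cong_def
proof (induction arbitrary: T)
  case (base u v)
  then have "(u, v) \<in> knuth p" by (auto simp: K1_def K2_def)
  then show ?case using base.prems
    by (intro foldl_row_insertion_knuth) (auto simp: super_tableaux_iff)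
next
  case (mult u v u' v')
  have "set v \<subseteq> L" using generated_congruence_lists[OF mult.hyps(1)] by auto
  then show ?case
    using mult.IH mult.prems foldl_row_insertion_super_tableaux by (metis foldl_append)
qed auto

lemma plactic_cong_iff:
  assumes "u \<in> lists L" "v \<in> lists L"
  shows "(u, v) \<in> plactic_cong L p \<longleftrightarrow> word_tableau p u = word_tableau p v"
proof
  assume "(u, v) \<in> plactic_cong L p"
  then show "word_tableau p u = word_tableau p v"
    unfolding word_tableau_def
    by (rule foldl_row_insertion_plactic_cong) (simp add: super_tableaux_iff)
next
  assume "word_tableau p u = word_tableau p v"
  then show "(u, v) \<in> plactic_cong L p"
    using assms plactic_cong_tableau_word plactic_cong_sym plactic_cong_trans by metis
qed

lemma plactic_class_eq_iff:
  assumes "u \<in> lists L" "v \<in> lists L"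
  shows "plactic_class L p u = plactic_class L p v \<longleftrightarrow> word_tableau p u = word_tableau p v"
  unfolding plactic_class_def plactic_cong_iff[OF assms, symmetric]
  using eq_equiv_class_iff[OF equiv_plactic_cong assms] .

theorem theorem3p11:
  fixes L :: "'a::linorder set" and p :: "'a \<Rightarrow> bit"
  assumes "countable L"
  shows "tableau_equiv L p = plactic_cong L p
    \<and> (\<exists>\<Phi>. (\<forall>w\<in>lists L. \<Phi> (plactic_class L p w) = word_tableau p w)
         \<and> bij_betw \<Phi> (carrier (plactic_monoid L p)) (super_tableaux L p)
         \<and> bij_betw (\<lambda>T. plactic_class L p (tableau_word T))
              (super_tableaux L p) (carrier (plactic_monoid L p))
         \<and> (\<forall>A\<in>carrier (plactic_monoid L p). plactic_class L p (tableau_word (\<Phi> A)) = A)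
         \<and> (\<forall>T\<in>super_tableaux L p. \<Phi> (plactic_class L p (tableau_word T)) = T))
    \<and> tableau_word ` super_tableaux L p \<subseteq> lists L
    \<and> (\<forall>A\<in>carrier (plactic_monoid L p). \<exists>!w. w \<in> tableau_word ` super_tableaux L p \<and> w \<in> A)"
proof (intro conjI)
  show "tableau_equiv L p = plactic_cong L p"
  proof (intro equalityI subrelI)
    fix u v
    assume "(u, v) \<in> tableau_equiv L p"
    then show "(u, v) \<in> plactic_cong L p"
      by (simp add: tableau_equiv_def plactic_cong_iff)
  next
    fix u v
    assume uv: "(u, v) \<in> plactic_cong L p"
    then have "u \<in> lists L" "v \<in> lists L"
      using generated_congruence_lists unfolding plactic_cong_def by blast+
    then show "(u, v) \<in> tableau_equiv L p"
      using uv by (simp add: tableau_equiv_def plactic_cong_iff)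
  qed
  show "tableau_word ` super_tableaux L p \<subseteq> lists L"
    using tableau_word_lists by blast
  let ?M = "carrier (plactic_monoid L p)" and ?S = "super_tableaux L p"
  let ?\<Psi> = "\<lambda>T. plactic_class L p (tableau_word T)"
  define \<Phi> where "\<Phi> A = word_tableau p (SOME w. w \<in> lists L \<and> plactic_class L p w = A)" for A
  have \<Phi>: "\<Phi> (plactic_class L p w) = word_tableau p w" if w: "w \<in> lists L" for w
  proof -
    let ?v = "SOME v. v \<in> lists L \<and> plactic_class L p v = plactic_class L p w"
    have "?v \<in> lists L \<and> plactic_class L p ?v = plactic_class L p w"
      by (rule someI[of _ w]) (use w in simp)
    then show ?thesis using plactic_class_eq_iff w unfolding \<Phi>_def by blast
  qed
  have \<Psi>\<Phi>: "?\<Psi> (\<Phi> A) = A" and \<Phi>S: "\<Phi> A \<in> ?S" if A: "A \<in> ?M" for A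
  proof -
    obtain w where w: "w \<in> lists L" "A = plactic_class L p w"
      using A unfolding carrier_plactic_monoid by blast
    then show "\<Phi> A \<in> ?S" using \<Phi> word_tableau_super_tableaux by metis
    then show "?\<Psi> (\<Phi> A) = A"
      using w \<Phi> plactic_class_eq_iff word_tableau_tableau_word tableau_word_lists by metis
  qed
  have \<Phi>\<Psi>: "\<Phi> (?\<Psi> T) = T" if "T \<in> ?S" for T
    using that \<Phi> word_tableau_tableau_word tableau_word_lists by metis
  have \<Psi>M: "?\<Psi> T \<in> ?M" if "T \<in> ?S" for T
    using that tableau_word_lists unfolding carrier_plactic_monoid by blast
  have "bij_betw \<Phi> ?M ?S"
    by (rule bij_betw_byWitness[where f' = ?\<Psi>]) (use \<Psi>\<Phi> \<Phi>S \<Phi>\<Psi> \<Psi>M in auto)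
  moreover have "bij_betw ?\<Psi> ?S ?M"
    by (rule bij_betw_byWitness[where f' = \<Phi>]) (use \<Psi>\<Phi> \<Phi>S \<Phi>\<Psi> \<Psi>M in auto)
  ultimately show "\<exists>\<Phi>. (\<forall>w\<in>lists L. \<Phi> (plactic_class L p w) = word_tableau p w)
      \<and> bij_betw \<Phi> ?M ?S \<and> bij_betw ?\<Psi> ?S ?M \<and> (\<forall>A\<in>?M. ?\<Psi> (\<Phi> A) = A) \<and> (\<forall>T\<in>?S. \<Phi> (?\<Psi> T) = T)"
    using \<Phi> \<Psi>\<Phi> \<Phi>\<Psi> by blast
  show "\<forall>A\<in>?M. \<exists>!w. w \<in> tableau_word ` ?S \<and> w \<in> A"
  proof
    fix A assume A: "A \<in> ?M"
    have "w \<in> A \<longleftrightarrow> plactic_class L p w = A" if "w \<in> lists L" for w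
    proof -
      obtain v where v: "v \<in> lists L" "A = plactic_class L p v"
        using A unfolding carrier_plactic_monoid by blast
      then show ?thesis
        using that plactic_cong_iff[of v L w p] plactic_class_eq_iff[of v L w p]
        by (auto simp: plactic_class_def)
    qed
    then have "tableau_word T \<in> A \<longleftrightarrow> T = \<Phi> A" if "T \<in> ?S" for T
      using that \<Psi>\<Phi>[OF A] \<Phi>\<Psi>[OF that] tableau_word_lists by metis
    then show "\<exists>!w. w \<in> tableau_word ` ?S \<and> w \<in> A"
      using \<Phi>S[OF A] by blast
  qed
qed

end
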